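(* Let $H_0,\dots,H_m\in\mathbb{R}^{n\times n}$ be symmetric matrices and let $G(\delta)=H_0+\sum_{i=1}^m\delta_iH_i$ for $\delta\in\mathbb{R}^m$. Let $f_1,\dots,f_m\in\mathbb{R}[\delta]=\mathbb{R}[\delta_1,\dots,\delta_m]$ and let $\Delta=\{\delta\in\mathbb{R}^m \mid f_i(\delta)\ge 0 \text{ for } i=1,\dots,m\}$. If there exist $n\times n$ sum-of-squares polynomial matrices $S_0,S_1,\dots,S_m$ in the variables $\delta$ satisfying the polynomial identity $$G(\delta)=S_0(\delta)+\sum_{i=1}^m f_i(\delta)\,S_i(\delta),$$ then $G(\delta)$ is positive semidefinite for all $\delta\in\Delta$.
   Context: A symmetric $n\times n$ polynomial matrix $S$ with entries in $\mathbb{R}[\delta]$ is called a sum-of-squares (SOS) if there exist $q$ and a polynomial matrix $T\in\mathbb{R}[\delta]^{n\times q}$ with $S(\delta)=T(\delta)T(\delta)^T$. *)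

theory Defs
  imports "HOL-Analysis.Analysis" "HOL-Library.Poly_Mapping"
begin

text \<open>Real polynomials in commuting variables indexed by the finite type \<open>'m\<close>, that is
  \<open>\<real>[\<delta>\<^sub>1, \<dots>, \<delta>\<^sub>m]\<close> with \<open>m = CARD('m)\<close>. A monomial is its exponent vector \<open>'m \<Rightarrow>\<^sub>0 nat\<close>;
  the ring operations on \<open>\<Rightarrow>\<^sub>0\<close> are the usual ones, multiplication being convolution.\<close>
type_synonym 'm rpoly = "('m \<Rightarrow>\<^sub>0 nat) \<Rightarrow>\<^sub>0 real"

definition rconst :: "real \<Rightarrow> 'm rpoly" where
  "rconst c = Poly_Mapping.single 0 c"

definition rvar :: "'m \<Rightarrow> 'm rpoly" where
  "rvar i = Poly_Mapping.single (Poly_Mapping.single i 1) 1"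

definition reval :: "('m::finite) rpoly \<Rightarrow> real ^ 'm \<Rightarrow> real" where
  "reval p \<delta> = (\<Sum>\<mu> \<in> Poly_Mapping.keys p.
      Poly_Mapping.lookup p \<mu> * (\<Prod>i\<in>UNIV. (\<delta> $ i) ^ Poly_Mapping.lookup \<mu> i))"

definition mat_scale :: "'a::times \<Rightarrow> 'a ^ 'k ^ 'n \<Rightarrow> 'a ^ 'k ^ 'n" where
  "mat_scale c A = (\<chi> i j. c * A $ i $ j)"

text \<open>The number \<open>q\<close> of columns of \<open>T\<close> is existentially quantified, so \<open>T\<close> cannot be a matrix
  with type-indexed columns. The entry of \<open>T\<close> in row \<open>i\<close> and column \<open>k < q\<close> is \<open>T i k\<close>, and
  the right-hand side is \<open>T T\<^sup>T\<close> written out entrywise.\<close>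
definition sos_matrix :: "('m rpoly) ^ 'n ^ 'n \<Rightarrow> bool" where
  "sos_matrix S \<longleftrightarrow> transpose S = S \<and>
     (\<exists>(q::nat) (T :: 'n \<Rightarrow> nat \<Rightarrow> 'm rpoly). S = (\<chi> i j. \<Sum>k<q. T i k * T j k))"

definition psd_matrix :: "real ^ 'n ^ 'n \<Rightarrow> bool" where
  "psd_matrix A \<longleftrightarrow> transpose A = A \<and> (\<forall>x. 0 \<le> x \<bullet> (A *v x))"

text \<open>The affine matrix function \<open>H\<^sub>0 + \<Sum>\<^sub>i \<delta>\<^sub>i H\<^sub>i\<close> occurs both as a matrix-valued function on
  \<open>\<real>\<^sup>m\<close> and as a matrix over the polynomial ring.\<close>
definition affine_fun ::
    "real ^ 'n ^ 'n \<Rightarrow> ('m::finite \<Rightarrow> real ^ 'n ^ 'n) \<Rightarrow> real ^ 'm \<Rightarrow> real ^ 'n ^ 'n" where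
  "affine_fun H0 H \<delta> = H0 + (\<Sum>i\<in>UNIV. \<delta> $ i *\<^sub>R H i)"

definition affine_poly ::
    "real ^ 'n ^ 'n \<Rightarrow> ('m::finite \<Rightarrow> real ^ 'n ^ 'n) \<Rightarrow> ('m rpoly) ^ 'n ^ 'n" where
  "affine_poly H0 H = map_matrix rconst H0 +
     (\<Sum>i\<in>UNIV. mat_scale (rvar i) (map_matrix rconst (H i)))"

definition semialg :: "('m::finite \<Rightarrow> 'm rpoly) \<Rightarrow> (real ^ 'm) set" where
  "semialg f = {\<delta>. \<forall>i. 0 \<le> reval (f i) \<delta>}"

end

theory Submission
  imports Defs
begin

text \<open>Evaluation at a point \<open>\<delta>\<close> is a ring homomorphism, so the polynomial identity becomes an
  identity of real matrices at \<open>\<delta>\<close>. There the value of each sum-of-squares matrix is \<open>T T\<^sup>T\<close> with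
  \<open>T\<close> real, hence positive semidefinite, and the weights \<open>f\<^sub>i(\<delta>)\<close> are nonnegative.\<close>

definition monom_eval :: "('m::finite \<Rightarrow>\<^sub>0 nat) \<Rightarrow> real ^ 'm \<Rightarrow> real" where
  "monom_eval \<mu> \<delta> = (\<Prod>i\<in>UNIV. (\<delta> $ i) ^ Poly_Mapping.lookup \<mu> i)"

lemma monom_eval_add: "monom_eval (\<mu> + \<nu>) \<delta> = monom_eval \<mu> \<delta> * monom_eval \<nu> \<delta>"
  by (simp add: monom_eval_def lookup_add power_add prod.distrib)

text \<open>Coefficients outside the key set vanish, so enlarging the index set changes nothing.
  This is what makes \<open>reval_add\<close> work: cancellation can make the keys of
  \<open>p + q\<close> a proper subset of the union, over which all three sums are therefore
  taken.\<close>

lemma reval_eq_sum_superset: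
  assumes "finite A" "Poly_Mapping.keys p \<subseteq> A"
  shows "reval p \<delta> = (\<Sum>\<mu>\<in>A. Poly_Mapping.lookup p \<mu> * monom_eval \<mu> \<delta>)"
  unfolding reval_def monom_eval_def
  by (rule sum.mono_neutral_left) (use assms in \<open>auto simp: in_keys_iff\<close>)

lemma reval_0 [simp]: "reval 0 \<delta> = 0"
  by (simp add: reval_def)

lemma reval_single: "reval (Poly_Mapping.single \<mu> c) \<delta> = c * monom_eval \<mu> \<delta>"
  by (subst reval_eq_sum_superset[of "{\<mu>}"]) auto

lemma reval_add: "reval (p + q) \<delta> = reval p \<delta> + reval q \<delta>"
proof -
  let ?A = "Poly_Mapping.keys p \<union> Poly_Mapping.keys q"
  have "reval (p + q) \<delta> = (\<Sum>\<mu>\<in>?A. Poly_Mapping.lookup (p + q) \<mu> * monom_eval \<mu> \<delta>)"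
    by (rule reval_eq_sum_superset) (simp_all add: Poly_Mapping.keys_add)
  also have "\<dots> = reval p \<delta> + reval q \<delta>"
    by (simp add: reval_eq_sum_superset[of ?A] lookup_add distrib_right sum.distrib)
  finally show ?thesis .
qed

lemma reval_sum: "reval (\<Sum>i\<in>A. p i) \<delta> = (\<Sum>i\<in>A. reval (p i) \<delta>)"
  by (induction A rule: infinite_finite_induct) (simp_all add: reval_add)

lemma poly_mapping_eq_sum_single:
  "p = (\<Sum>\<mu>\<in>Poly_Mapping.keys p. Poly_Mapping.single \<mu> (Poly_Mapping.lookup p \<mu>))"
  by (rule poly_mapping_eqI) (simp add: lookup_sum lookup_single when_def in_keys_iff)

text \<open>Expanding both factors into single terms avoids any direct handling of the convolution.
  A product of two single terms has the sum of their exponents, and \<open>monom_eval_add\<close>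
  turns that sum into a product of values.\<close>

lemma reval_mult: "reval (p * q) \<delta> = reval p \<delta> * reval q \<delta>"
proof -
  let ?s = "\<lambda>r \<mu>. Poly_Mapping.single \<mu> (Poly_Mapping.lookup r \<mu>)"
  have "p * q = (\<Sum>\<mu>\<in>Poly_Mapping.keys p. ?s p \<mu>) * (\<Sum>\<nu>\<in>Poly_Mapping.keys q. ?s q \<nu>)"
    by (simp flip: poly_mapping_eq_sum_single)
  also have "\<dots> = (\<Sum>\<mu>\<in>Poly_Mapping.keys p. \<Sum>\<nu>\<in>Poly_Mapping.keys q. ?s p \<mu> * ?s q \<nu>)"
    by (rule sum_product)
  also have "reval \<dots> \<delta> = reval p \<delta> * reval q \<delta>"
    by (simp add: reval_sum mult_single reval_single monom_eval_add sum_product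
        reval_eq_sum_superset[OF finite_keys order_refl, of p]
        reval_eq_sum_superset[OF finite_keys order_refl, of q] mult_ac)
  finally show ?thesis .
qed

lemma reval_rconst [simp]: "reval (rconst c) \<delta> = c"
  by (simp add: rconst_def reval_single monom_eval_def)

lemma reval_rvar [simp]: "reval (rvar i) \<delta> = \<delta> $ i"
proof -
  \<comment> \<open>Every variable other than \<open>i\<close> has exponent 0 and contributes the
    factor 1, even where its value is 0, since \<open>0 ^ 0 = 1\<close>.\<close>
  have "monom_eval (Poly_Mapping.single i 1) \<delta> = (\<Prod>j\<in>UNIV. if i = j then \<delta> $ j else 1)"
    unfolding monom_eval_def by (rule prod.cong) (auto simp: lookup_single when_def)
  then show ?thesis
    by (simp add: rvar_def reval_single)
qed

lemma map_matrix_reval_add: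
  "map_matrix (\<lambda>p. reval p \<delta>) (A + B) = map_matrix (\<lambda>p. reval p \<delta>) A + map_matrix (\<lambda>p. reval p \<delta>) B"
  by (simp add: map_matrix_def vec_eq_iff reval_add)

lemma map_matrix_reval_sum:
  "map_matrix (\<lambda>p. reval p \<delta>) (\<Sum>i\<in>I. A i) = (\<Sum>i\<in>I. map_matrix (\<lambda>p. reval p \<delta>) (A i))"
  by (simp add: map_matrix_def vec_eq_iff sum_component reval_sum)

lemma map_matrix_reval_mat_scale:
  "map_matrix (\<lambda>p. reval p \<delta>) (mat_scale c A) = reval c \<delta> *\<^sub>R map_matrix (\<lambda>p. reval p \<delta>) A"
  by (simp add: map_matrix_def mat_scale_def vec_eq_iff reval_mult)

lemma map_matrix_reval_rconst: "map_matrix (\<lambda>p. reval p \<delta>) (map_matrix rconst A) = A"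
  by (simp add: map_matrix_def vec_eq_iff)

text \<open>Links the two forms of G: the matrix over the polynomial ring, for which the identity is
  assumed, and the real matrix function, of which positivity is claimed.\<close>

lemma map_matrix_reval_affine_poly:
  "map_matrix (\<lambda>p. reval p \<delta>) (affine_poly H0 H) = affine_fun H0 H \<delta>"
  by (simp add: affine_poly_def affine_fun_def map_matrix_reval_add map_matrix_reval_sum
      map_matrix_reval_mat_scale map_matrix_reval_rconst)

lemma psd_matrix_add:
  assumes "psd_matrix A" "psd_matrix B"
  shows "psd_matrix (A + B)"
  using assms by (simp add: psd_matrix_def transpose_def vec_eq_iff matrix_vector_mult_add_rdistrib
      inner_add_right)

lemma psd_matrix_scaleR:
  assumes "psd_matrix A" "0 \<le> c"
  shows "psd_matrix (c *\<^sub>R A)"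
  using assms by (simp add: psd_matrix_def transpose_def vec_eq_iff flip: scaleR_matrix_vector_assoc)

lemma psd_matrix_sum:
  assumes "\<And>i. i \<in> I \<Longrightarrow> psd_matrix (A i)"
  shows "psd_matrix (\<Sum>i\<in>I. A i)"
  using assms
proof (induction I rule: infinite_finite_induct)
  case (insert i I)
  then show ?case
    by (simp add: psd_matrix_add)
\<comment> \<open>A sum over an infinite index set is 0 by convention, so this case, like the empty
  one, only asks that the zero matrix be positive semidefinite.\<close>
qed (simp_all add: psd_matrix_def transpose_def vec_eq_iff)

text \<open>The quadratic form of \<open>T T\<^sup>T\<close> at \<open>x\<close> is the squared
  Euclidean norm of \<open>T\<^sup>T x\<close>, whose coordinates are indexed by
  \<open>k < q\<close>.\<close>

lemma psd_matrix_gram: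
  fixes T :: "'n::finite \<Rightarrow> nat \<Rightarrow> real"
  shows "psd_matrix (\<chi> i j. \<Sum>k<q. T i k * T j k)"
proof -
  let ?G = "(\<chi> i j. \<Sum>k<q. T i k * T j k) :: real ^ 'n ^ 'n"
  have "x \<bullet> (?G *v x) = (\<Sum>k<q. (\<Sum>i\<in>UNIV. x $ i * T i k)\<^sup>2)" for x
  proof -
    have "x \<bullet> (?G *v x) = (\<Sum>i\<in>UNIV. \<Sum>j\<in>UNIV. \<Sum>k<q. (x $ i * T i k) * (x $ j * T j k))"
      by (simp add: inner_vec_def matrix_vector_mult_def sum_distrib_left sum_distrib_right mult_ac)
    \<comment> \<open>Two exchanges bring \<open>k\<close> to the outside; for fixed
      \<open>k\<close> the remaining double sum over \<open>i\<close> and \<open>j\<close> factors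
      as a square.\<close>
    also have "\<dots> = (\<Sum>i\<in>UNIV. \<Sum>k<q. \<Sum>j\<in>UNIV. (x $ i * T i k) * (x $ j * T j k))"
      by (intro sum.cong refl sum.swap)
    also have "\<dots> = (\<Sum>k<q. \<Sum>i\<in>UNIV. \<Sum>j\<in>UNIV. (x $ i * T i k) * (x $ j * T j k))"
      by (rule sum.swap)
    also have "\<dots> = (\<Sum>k<q. (\<Sum>i\<in>UNIV. x $ i * T i k)\<^sup>2)"
      by (simp add: power2_eq_square sum_product)
    finally show ?thesis .
  qed
  then show ?thesis
    by (simp add: psd_matrix_def transpose_def mult.commute sum_nonneg)
qed

lemma psd_matrix_reval_sos:
  assumes "sos_matrix S"
  shows "psd_matrix (map_matrix (\<lambda>p. reval p \<delta>) S)"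
proof -
  obtain q T where "S = (\<chi> i j. \<Sum>k<(q::nat). T i k * T j k)"
    using assms unfolding sos_matrix_def by blast
  then have "map_matrix (\<lambda>p. reval p \<delta>) S = (\<chi> i j. \<Sum>k<q. reval (T i k) \<delta> * reval (T j k) \<delta>)"
    by (simp add: map_matrix_def vec_eq_iff reval_sum reval_mult)
  then show ?thesis
    by (simp only: psd_matrix_gram)
qed

theorem theorem6:
  fixes H0 :: "real ^ 'n ^ 'n"
    and H :: "'m::finite \<Rightarrow> real ^ 'n ^ 'n"
    and f :: "'m \<Rightarrow> 'm rpoly"
  assumes "transpose H0 = H0"
    and "\<And>i. transpose (H i) = H i"
    and "\<exists>(S0 :: ('m rpoly) ^ 'n ^ 'n) (S :: 'm \<Rightarrow> ('m rpoly) ^ 'n ^ 'n).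
           sos_matrix S0 \<and> (\<forall>i. sos_matrix (S i)) \<and>
           affine_poly H0 H = S0 + (\<Sum>i\<in>UNIV. mat_scale (f i) (S i))"
  shows "\<forall>\<delta> \<in> semialg f. psd_matrix (affine_fun H0 H \<delta>)"
proof
  fix \<delta> assume "\<delta> \<in> semialg f"
  then have f: "0 \<le> reval (f i) \<delta>" for i
    by (simp add: semialg_def)
  obtain S0 S where sos: "sos_matrix S0" "\<And>i. sos_matrix (S i)"
    and id: "affine_poly H0 H = S0 + (\<Sum>i\<in>UNIV. mat_scale (f i) (S i))"
    using assms(3) by blast
  \<comment> \<open>Entrywise evaluation is applied to both sides of \<open>id\<close>.
    Multiplication by the polynomial \<open>f i\<close> becomes scaling by a real number,
    nonnegative by the fact \<open>f\<close>.\<close>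
  have "affine_fun H0 H \<delta> = map_matrix (\<lambda>p. reval p \<delta>) S0
      + (\<Sum>i\<in>UNIV. reval (f i) \<delta> *\<^sub>R map_matrix (\<lambda>p. reval p \<delta>) (S i))"
    using arg_cong[OF id, of "map_matrix (\<lambda>p. reval p \<delta>)"]
    by (simp add: map_matrix_reval_affine_poly map_matrix_reval_add map_matrix_reval_sum
        map_matrix_reval_mat_scale)
  then show "psd_matrix (affine_fun H0 H \<delta>)"
    by (simp add: psd_matrix_add psd_matrix_sum psd_matrix_scaleR psd_matrix_reval_sos sos f)
qed

end
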